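(* Let $\alpha_1\in(0,1)$, $\nu_{\rm inc}>1$, $\mu_k>0$, $x_k\in\mathcal X_0$, and let $H_k^+\succeq0$ be a fixed symmetric positive semidefinite matrix. Consider the inner loop at $x_k$ described in the context, started with scalar weight $\mu_k$: the metric is $Q_k=\mu_kI+H_k^+$ with $H_k^+$ fixed within the loop, and $\mu_k\leftarrow\nu_{\rm inc}\mu_k$ on each rejection. Write $L_U:=L_h\beta_C+L_R^2\beta_s$ and $\psi:=L_U/(2-\alpha_1)$. Then after at most $$N_k\ \le\ \Big\lceil \log(\psi/\mu_k)\big/\log(\nu_{\rm inc})\Big\rceil_+$$ rejections (with $\mu_k$ in this bound the initial weight of the loop) we have $\lambda_{\min}(Q_k)\ge\psi$, so the step is accepted. In particular, if $\mu_k\ge\psi$ then $N_k=0$. Here $\lceil\cdot\rceil_+:=\max\{0,\lceil\cdot\rceil\}$.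
   Context: **Problem.** $F(x)=g(x)+h(C(x))+s(R(x))$ on $\mathbb R^m$, where $g:\mathbb R^m\to\mathbb R\cup\{+\infty\}$ is proper, closed, convex; $h:\mathbb R^d\to\mathbb R$ is finite-valued, closed, convex; $C:\mathbb R^m\to\mathbb R^d$ and $s:\mathbb R^n\to\mathbb R$ are $\mathcal C^1$; $R=(r_1,\dots,r_n)$ with each $r_i:\mathbb R^m\to\mathbb R$ finite-valued, closed, convex. $\|\cdot\|$ is the Euclidean norm on vectors and the spectral norm on matrices; $\|u\|_Q^2:=u^\top Qu$. **Standing assumptions.** (1) Monotone-or-smooth: for each $\bar x\in\operatorname{dom}F$ there is a neighborhood $W$ of $R(\bar x)$ such that, for every $i$, if $r_i$ is not $\mathcal C^1$ on any neighborhood of $\bar x$ then $\nabla_i s(z)\ge0$ for all $z\in W$. (2) A starting point $x_0\in\operatorname{dom}F$ is fixed, and $\mathcal X_0:=\{x\in\operatorname{dom}F: F(x)\le F(x_0)\}$ is nonempty and compact. (3) $h$ is $L_h$-Lipschitz; $C$ has $\beta_C$-Lipschitz Jacobian; $s$ has $\beta_s$-Lipschitz gradient; each $r_i$ is $L_{r_i}$-Lipschitz, and $L_R:=\|(L_{r_1},\dots,L_{r_n})\|_2$. (4) Let $\mathcal I^-$ be the set of indices $i$ with $\nabla_i s(R(x))<0$ for some $x\in\mathcal X_0$. If $\mathcal I^-\ne\emptyset$, then $\|\nabla s(y)\|\le L_s$ for all $y\in\{R(x):F(x)\le F(x_0)\}$, and each $r_i$, $i\in\mathcal I^-$, is $\mathcal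 C^1$ with $\beta_{r_i}$-Lipschitz gradient. **Model.** For $x_k\in\mathcal X_0$, $$F(x;x_k)=g(x)+h\big(C(x_k)+\nabla C(x_k)(x-x_k)\big)+s(R(x_k))+\sum_{i=1}^n\nabla_i s(R(x_k))\,\Phi_i(x;x_k),$$ where $\Phi_i(x;x_k)=r_i(x)-r_i(x_k)$ if $\nabla_i s(R(x_k))\ge0$, and $\Phi_i(x;x_k)=\nabla r_i(x_k)^\top(x-x_k)$ if $\nabla_i s(R(x_k))<0$. The proximal model is $F_{Q}(x;x_k)=F(x;x_k)+\tfrac12\|x-x_k\|_{Q}^2$. **Inner loop at $x_k$.** Repeat: set $Q_k=\mu_kI+H_k^+$; compute the trial point $x_k^+=\arg\min_xF_{Q_k}(x;x_k)$, $\mathrm{Pred}_k=F(x_k)-F_{Q_k}(x_k^+;x_k)$ and $\mathrm{Act}_k=F(x_k)-F(x_k^+)$. If $\mathrm{Pred}_k=0$ the whole algorithm terminates (such trials are excluded from the statement). Otherwise set $\rho_k=\mathrm{Act}_k/\mathrm{Pred}_k$; the trial is accepted if $\rho_k\ge\alpha_1$ (the loop ends), and rejected if $\rho_k<\alpha_1$, in which case $\mu_k\leftarrow\nu_{\rm inc}\mu_k$ and the loop repeats. When $\psi=0$ the bound is read as $0$. *)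

theory Defs
  imports "HOL-Analysis.Analysis" "HOL-Library.Extended_Nat"
begin

section \<open>Extended-real-valued convex functions\<close>

definition effective_domain :: "('a \<Rightarrow> ereal) \<Rightarrow> 'a set" where
  "effective_domain f = {x. f x < \<infinity>}"

definition proper_fun :: "('a \<Rightarrow> ereal) \<Rightarrow> bool" where
  "proper_fun f \<longleftrightarrow> (\<forall>x. f x \<noteq> -\<infinity>) \<and> effective_domain f \<noteq> {}"

text \<open>The library's \<^const>\<open>epigraph\<close> is for real-valued functions only. As usual, an
  extended-real-valued function is called convex (closed) if its epigraph is convex (closed).\<close>

definition ereal_epigraph :: "('a \<Rightarrow> ereal) \<Rightarrow> ('a \<times> real) set" where
  "ereal_epigraph f = {(x, t). f x \<le> ereal t}"

section \<open>Derivatives and eigenvalues\<close>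

text \<open>Meant for open \<open>S\<close>; continuity of the derivative is with respect to the operator norm.\<close>

definition C1_on :: "('a::real_normed_vector \<Rightarrow> 'b::real_normed_vector) \<Rightarrow> 'a set \<Rightarrow> bool" where
  "C1_on f S \<longleftrightarrow> (\<exists>f' :: 'a \<Rightarrow> 'a \<Rightarrow>\<^sub>L 'b.
     (\<forall>x\<in>S. (f has_derivative blinfun_apply (f' x)) (at x)) \<and> continuous_on S f')"

text \<open>Only meaningful at points where \<open>f\<close> is differentiable.\<close>

definition grad :: "('a::real_inner \<Rightarrow> real) \<Rightarrow> 'a \<Rightarrow> 'a" where
  "grad f x = (THE D. GDERIV f x :> D)"

text \<open>The norm of the type of matrices is the Frobenius norm, hence a separate spectral norm.\<close>

definition spectral_norm :: "real^'m^'d \<Rightarrow> real" where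
  "spectral_norm A = onorm (\<lambda>v. A *v v)"

definition eigenvalues :: "real^'m^'m \<Rightarrow> real set" where
  "eigenvalues A = {l. \<exists>v. v \<noteq> 0 \<and> A *v v = l *\<^sub>R v}"

text \<open>Used for symmetric matrices only, for which the set of (real) eigenvalues is finite and
  nonempty.\<close>

definition lambda_min :: "real^'m^'m \<Rightarrow> real" where
  "lambda_min A = Min (eigenvalues A)"

definition psd :: "real^'m^'m \<Rightarrow> bool" where
  "psd A \<longleftrightarrow> transpose A = A \<and> (\<forall>v. 0 \<le> v \<bullet> (A *v v))"

section \<open>The composite problem and its proximal model\<close>

definition Rmap :: "('n::finite \<Rightarrow> real^'m \<Rightarrow> real) \<Rightarrow> real^'m \<Rightarrow> real^'n" where
  "Rmap r x = (\<chi> i. r i x)"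

definition objective ::
  "(real^'m \<Rightarrow> ereal) \<Rightarrow> (real^'d \<Rightarrow> real) \<Rightarrow> (real^'m \<Rightarrow> real^'d) \<Rightarrow> (real^'n \<Rightarrow> real) \<Rightarrow>
   ('n \<Rightarrow> real^'m \<Rightarrow> real) \<Rightarrow> real^'m \<Rightarrow> ereal" where
  "objective g h C s r x = g x + ereal (h (C x)) + ereal (s (Rmap r x))"

definition initial_level_set :: "(real^'m \<Rightarrow> ereal) \<Rightarrow> real^'m \<Rightarrow> (real^'m) set" where
  "initial_level_set F x0 = {x \<in> effective_domain F. F x \<le> F x0}"

definition Phi ::
  "(real^'n \<Rightarrow> real) \<Rightarrow> ('n \<Rightarrow> real^'m \<Rightarrow> real) \<Rightarrow> 'n \<Rightarrow> real^'m \<Rightarrow> real^'m \<Rightarrow> real" where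
  "Phi s r i x xk =
     (if grad s (Rmap r xk) $ i \<ge> 0 then r i x - r i xk else grad (r i) xk \<bullet> (x - xk))"

definition model ::
  "(real^'m \<Rightarrow> ereal) \<Rightarrow> (real^'d \<Rightarrow> real) \<Rightarrow> (real^'m \<Rightarrow> real^'d) \<Rightarrow> (real^'n \<Rightarrow> real) \<Rightarrow>
   ('n \<Rightarrow> real^'m \<Rightarrow> real) \<Rightarrow> real^'m \<Rightarrow> real^'m \<Rightarrow> ereal" where
  "model g h C s r xk x =
     g x + ereal (h (C xk + jacobian C (at xk) *v (x - xk))) + ereal (s (Rmap r xk))
     + ereal (\<Sum>i\<in>UNIV. grad s (Rmap r xk) $ i * Phi s r i x xk)"

definition prox_model ::
  "(real^'m \<Rightarrow> ereal) \<Rightarrow> (real^'d \<Rightarrow> real) \<Rightarrow> (real^'m \<Rightarrow> real^'d) \<Rightarrow> (real^'n \<Rightarrow> real) \<Rightarrow>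
   ('n \<Rightarrow> real^'m \<Rightarrow> real) \<Rightarrow> real^'m \<Rightarrow> real^'m^'m \<Rightarrow> real^'m \<Rightarrow> ereal" where
  "prox_model g h C s r xk Q x = model g h C s r xk x + ereal (1/2 * ((x - xk) \<bullet> (Q *v (x - xk))))"

section \<open>The inner loop\<close>

definition trial_point ::
  "(real^'m \<Rightarrow> ereal) \<Rightarrow> (real^'d \<Rightarrow> real) \<Rightarrow> (real^'m \<Rightarrow> real^'d) \<Rightarrow> (real^'n \<Rightarrow> real) \<Rightarrow>
   ('n \<Rightarrow> real^'m \<Rightarrow> real) \<Rightarrow> real^'m \<Rightarrow> real^'m^'m \<Rightarrow> real^'m" where
  "trial_point g h C s r xk Q = arg_min (prox_model g h C s r xk Q) (\<lambda>x. True)"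

definition Pred ::
  "(real^'m \<Rightarrow> ereal) \<Rightarrow> (real^'d \<Rightarrow> real) \<Rightarrow> (real^'m \<Rightarrow> real^'d) \<Rightarrow> (real^'n \<Rightarrow> real) \<Rightarrow>
   ('n \<Rightarrow> real^'m \<Rightarrow> real) \<Rightarrow> real^'m \<Rightarrow> real^'m^'m \<Rightarrow> ereal" where
  "Pred g h C s r xk Q =
     objective g h C s r xk - prox_model g h C s r xk Q (trial_point g h C s r xk Q)"

definition Act ::
  "(real^'m \<Rightarrow> ereal) \<Rightarrow> (real^'d \<Rightarrow> real) \<Rightarrow> (real^'m \<Rightarrow> real^'d) \<Rightarrow> (real^'n \<Rightarrow> real) \<Rightarrow>
   ('n \<Rightarrow> real^'m \<Rightarrow> real) \<Rightarrow> real^'m \<Rightarrow> real^'m^'m \<Rightarrow> ereal" where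
  "Act g h C s r xk Q =
     objective g h C s r xk - objective g h C s r (trial_point g h C s r xk Q)"

text \<open>A trial with \<open>Pred = 0\<close> is neither accepted nor rejected: it ends the whole algorithm.\<close>

definition accepted ::
  "(real^'m \<Rightarrow> ereal) \<Rightarrow> (real^'d \<Rightarrow> real) \<Rightarrow> (real^'m \<Rightarrow> real^'d) \<Rightarrow> (real^'n \<Rightarrow> real) \<Rightarrow>
   ('n \<Rightarrow> real^'m \<Rightarrow> real) \<Rightarrow> real \<Rightarrow> real^'m \<Rightarrow> real^'m^'m \<Rightarrow> bool" where
  "accepted g h C s r \<alpha>1 xk Q \<longleftrightarrow>
     Pred g h C s r xk Q \<noteq> 0 \<and> Act g h C s r xk Q / Pred g h C s r xk Q \<ge> ereal \<alpha>1"

definition rejected ::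
  "(real^'m \<Rightarrow> ereal) \<Rightarrow> (real^'d \<Rightarrow> real) \<Rightarrow> (real^'m \<Rightarrow> real^'d) \<Rightarrow> (real^'n \<Rightarrow> real) \<Rightarrow>
   ('n \<Rightarrow> real^'m \<Rightarrow> real) \<Rightarrow> real \<Rightarrow> real^'m \<Rightarrow> real^'m^'m \<Rightarrow> bool" where
  "rejected g h C s r \<alpha>1 xk Q \<longleftrightarrow>
     Pred g h C s r xk Q \<noteq> 0 \<and> Act g h C s r xk Q / Pred g h C s r xk Q < ereal \<alpha>1"

text \<open>\<open>loop_weight \<nu> \<mu> j\<close> and \<open>loop_metric \<nu> \<mu> H j\<close> are the weight and the metric in force after
  \<open>j\<close> rejections, in a loop started with weight \<open>\<mu>\<close>.\<close>

primrec loop_weight :: "real \<Rightarrow> real \<Rightarrow> nat \<Rightarrow> real" where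
  "loop_weight \<nu> \<mu> 0 = \<mu>"
| "loop_weight \<nu> \<mu> (Suc j) = \<nu> * loop_weight \<nu> \<mu> j"

definition loop_metric :: "real \<Rightarrow> real \<Rightarrow> real^'m^'m \<Rightarrow> nat \<Rightarrow> real^'m^'m" where
  "loop_metric \<nu> \<mu> H j = loop_weight \<nu> \<mu> j *\<^sub>R mat 1 + H"

text \<open>The number of rejections made by the loop before it ends, i.e. the supremum of all \<open>N\<close> such
  that the first \<open>N\<close> trials are rejected; it is \<open>\<infinity>\<close> if the loop does not end.\<close>

definition num_rejections ::
  "(real^'m \<Rightarrow> ereal) \<Rightarrow> (real^'d \<Rightarrow> real) \<Rightarrow> (real^'m \<Rightarrow> real^'d) \<Rightarrow> (real^'n \<Rightarrow> real) \<Rightarrow>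
   ('n \<Rightarrow> real^'m \<Rightarrow> real) \<Rightarrow> real \<Rightarrow> real \<Rightarrow> real \<Rightarrow> real^'m^'m \<Rightarrow> real^'m \<Rightarrow> enat" where
  "num_rejections g h C s r \<alpha>1 \<nu> \<mu> H xk =
     (SUP N \<in> {N. \<forall>j<N. rejected g h C s r \<alpha>1 xk (loop_metric \<nu> \<mu> H j)}. enat N)"

definition rejection_bound :: "real \<Rightarrow> real \<Rightarrow> real \<Rightarrow> nat" where
  "rejection_bound \<psi> \<mu> \<nu> = (if \<psi> = 0 then 0 else nat (max 0 \<lceil>ln (\<psi> / \<mu>) / ln \<nu>\<rceil>))"

end

theory Submission
  imports Defs
begin

text \<open>
  The model \<open>M\<close> at \<open>xk\<close> satisfies \<open>F x \<le> M x + L_U / 2 \<parallel>x - xk\<parallel>\<^sup>2\<close> with equality at \<open>xk\<close>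
  (\<open>objective_le_model\<close>). On the other hand \<open>M\<close> is convex, so a minimizer \<open>p\<close> of \<open>M\<close> plus half the
  quadratic form of \<open>Q\<close> has \<open>M p + c \<le> F xk\<close>, where \<open>c\<close> is the full quadratic form at \<open>p - xk\<close>
  (\<open>minimizer_of_quadratic_perturbation_decrease\<close>). In other words \<open>Pred \<ge> c / 2\<close>;
  in particular a nonzero \<open>Pred\<close> is positive. The two facts
  together yield

  \<open>Act - \<alpha>1 Pred \<ge> ((2 - \<alpha>1) c - L_U \<parallel>p - xk\<parallel>\<^sup>2) / 2\<close>,

  and the right-hand side is nonnegative if \<open>\<lambda>\<^sub>m\<^sub>i\<^sub>n Q \<ge> \<psi> = L_U / (2 - \<alpha>1)\<close>: this is where \<open>\<psi>\<close> comes from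
  (\<open>accepted_if_curvature_dominates\<close>). The smallest eigenvalue of the metric is at least the weight,
  and the weight grows geometrically, so it reaches \<open>\<psi>\<close> after at most
  \<open>\<lceil>log (\<psi> / \<mu>) / log \<nu>\<rceil>\<^sub>+\<close> rejections.

  Two facts are silent in this argument. The trial point is only a chosen \<open>arg_min\<close>, which minimizes
  nothing unless a minimizer exists; existence is \<open>ex_minimizer_of_quadratic_growth\<close>. Likewise
  \<^const>\<open>lambda_min\<close> is the \<^const>\<open>Min\<close> of a set of eigenvalues, and it bounds the quadratic form
  from below because the minimal Rayleigh quotient is an eigenvalue and eigenvalues are finite in
  number (\<open>lambda_min_le_rayleigh\<close>).
\<close>

section \<open>The smallest eigenvalue of a symmetric matrix\<close>

lemma inner_matrix_vector_symmetric:
  fixes A :: "real^'m^'m"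
  assumes "transpose A = A"
  shows "u \<bullet> (A *v v) = (A *v u) \<bullet> v"
  using dot_lmul_matrix[of u A v] transpose_matrix_vector[of A u] assms by simp

text \<open>For \<open>u = A v\<close>, the form at \<open>v - t u\<close> is \<open>- 2 t (u \<bullet> u) + O(t\<^sup>2)\<close>, which is
  negative for small \<open>t > 0\<close> unless \<open>u = 0\<close>.\<close>
lemma psd_isotropic_imp_kernel:
  fixes A :: "real^'m^'m"
  assumes A: "psd A" and v: "v \<bullet> (A *v v) = 0"
  shows "A *v v = 0"
proof (rule ccontr)
  define u where "u = A *v v"
  define b where "b = u \<bullet> u"
  define c where "c = u \<bullet> (A *v u)"
  \<comment> \<open>The quadratic \<open>- 2 t b + t\<^sup>2 c\<close> is minimal at \<open>t = b / c\<close>; the shift by one allows \<open>c = 0\<close>.\<close>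
  define t where "t = b / (c + 1)"
  assume "A *v v \<noteq> 0"
  then have b: "b > 0" by (simp add: b_def u_def)
  have c: "c \<ge> 0" using A by (simp add: c_def psd_def)
  have vu: "v \<bullet> (A *v u) = b"
    using A by (simp add: psd_def b_def u_def inner_matrix_vector_symmetric)
  have "0 \<le> (v - t *\<^sub>R u) \<bullet> (A *v (v - t *\<^sub>R u))"
    using A by (simp add: psd_def)
  also have "\<dots> = - 2 * t * b + t\<^sup>2 * c"
    using v vu
    by (simp add: matrix_vector_mult_diff_distrib matrix_vector_mult_scaleR inner_diff_left
        inner_diff_right b_def c_def u_def[symmetric] power2_eq_square algebra_simps)
  also have "\<dots> = t\<^sup>2 * (c - 2 * (c + 1))"
  proof -
    have "b = t * (c + 1)" using c by (simp add: t_def)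
    then show ?thesis by (simp add: power2_eq_square algebra_simps)
  qed
  also have "\<dots> < 0"
    using b c by (intro mult_pos_neg) (auto simp: t_def)
  finally show False by simp
qed

text \<open>Eigenvectors of a symmetric matrix for distinct eigenvalues are orthogonal, hence linearly
  independent, and a linearly independent set is finite.\<close>
lemma finite_eigenvalues_symmetric:
  fixes A :: "real^'m^'m"
  assumes A: "transpose A = A"
  shows "finite (eigenvalues A)"
proof -
  have "\<forall>l\<in>eigenvalues A. \<exists>v. v \<noteq> 0 \<and> A *v v = l *\<^sub>R v"
    by (auto simp: eigenvalues_def)
  then obtain e where e: "\<And>l. l \<in> eigenvalues A \<Longrightarrow> e l \<noteq> 0 \<and> A *v e l = l *\<^sub>R e l"
    by metis
  have orth: "e l \<bullet> e k = 0" if "l \<in> eigenvalues A" "k \<in> eigenvalues A" "l \<noteq> k" for l k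
  proof -
    have "k * (e l \<bullet> e k) = e l \<bullet> (A *v e k)" using e that by simp
    also have "\<dots> = (A *v e l) \<bullet> e k" by (rule inner_matrix_vector_symmetric[OF A])
    also have "\<dots> = l * (e l \<bullet> e k)" using e that by simp
    finally show ?thesis using that by simp
  qed
  have "inj_on e (eigenvalues A)"
    by (rule inj_onI) (metis e inner_eq_zero_iff orth)
  moreover have "independent (e ` eigenvalues A)"
  proof (rule pairwise_orthogonal_independent)
    show "pairwise orthogonal (e ` eigenvalues A)"
      by (auto simp: pairwise_def orthogonal_def) (metis orth)
    show "0 \<notin> e ` eigenvalues A" using e by force
  qed
  ultimately show ?thesis
    using independent_imp_finite finite_imageD by blast
qed

text \<open>The eigenvalue is the minimum \<open>l\<close> of the Rayleigh quotient, attained at a unit vector \<open>v\<close> by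
  compactness of the sphere. Then \<open>A - l I\<close> is positive semidefinite and its form vanishes at \<open>v\<close>,
  so \<open>v\<close> is in its kernel.\<close>
lemma ex_eigenvalue_rayleigh_bound:
  fixes A :: "real^'m^'m"
  assumes A: "transpose A = A"
  obtains l where "l \<in> eigenvalues A" "\<And>v. l * (v \<bullet> v) \<le> v \<bullet> (A *v v)"
proof -
  let ?q = "\<lambda>v. v \<bullet> (A *v v)"
  have "compact (sphere (0::real^'m) 1)" "sphere (0::real^'m) 1 \<noteq> {}" by auto
  moreover have "continuous_on (sphere 0 1) ?q"
    by (intro continuous_intros matrix_vector_mult_linear_continuous_on)
  ultimately obtain v where v: "norm v = 1" and min: "\<And>u. norm u = 1 \<Longrightarrow> ?q v \<le> ?q u"
    using continuous_attains_inf[of "sphere (0::real^'m) 1" ?q] by auto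
  define l where "l = ?q v"
  have bound: "l * (u \<bullet> u) \<le> ?q u" for u
  proof (cases "u = 0")
    case False
    then have "l \<le> ?q ((1 / norm u) *\<^sub>R u)" unfolding l_def by (intro min) simp
    also have "\<dots> = ?q u / (norm u)\<^sup>2"
      by (simp add: matrix_vector_mult_scaleR power2_eq_square)
    finally show ?thesis
      using False by (simp add: field_simps power2_norm_eq_inner)
  qed simp
  have "transpose (A - l *\<^sub>R mat 1) = A - l *\<^sub>R mat 1"
    using A by (auto simp: transpose_def mat_def vec_eq_iff)
  then have "psd (A - l *\<^sub>R mat 1)"
    unfolding psd_def using bound
    by (simp add: matrix_vector_mult_diff_rdistrib scaleR_matrix_vector_assoc[symmetric]
        inner_diff_right)
  moreover have "v \<bullet> ((A - l *\<^sub>R mat 1) *v v) = 0"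
    using v by (simp add: matrix_vector_mult_diff_rdistrib scaleR_matrix_vector_assoc[symmetric]
        inner_diff_right l_def dot_square_norm)
  ultimately have "(A - l *\<^sub>R mat 1) *v v = 0" by (rule psd_isotropic_imp_kernel)
  then have "A *v v = l *\<^sub>R v"
    by (simp add: matrix_vector_mult_diff_rdistrib scaleR_matrix_vector_assoc[symmetric])
  then have "l \<in> eigenvalues A"
    using v by (auto simp: eigenvalues_def intro!: exI[of _ v])
  then show ?thesis using bound that by blast
qed

text \<open>Here finiteness of the set of eigenvalues matters: \<^const>\<open>lambda_min\<close> is a \<^const>\<open>Min\<close>, so
  without it there would be no bound of \<^const>\<open>lambda_min\<close> by the eigenvalue of the previous
  lemma.\<close>
lemma lambda_min_le_rayleigh:
  fixes A :: "real^'m^'m"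
  assumes A: "transpose A = A"
  shows "lambda_min A * (v \<bullet> v) \<le> v \<bullet> (A *v v)"
proof -
  obtain l where l: "l \<in> eigenvalues A" "\<And>v. l * (v \<bullet> v) \<le> v \<bullet> (A *v v)"
    using ex_eigenvalue_rayleigh_bound[OF A] by blast
  have "lambda_min A \<le> l"
    unfolding lambda_min_def using l finite_eigenvalues_symmetric[OF A] by simp
  then show ?thesis
    using l(2)[of v] by (meson inner_ge_zero mult_right_mono order_trans)
qed

lemma lambda_min_geI:
  fixes A :: "real^'m^'m"
  assumes A: "transpose A = A" and w: "\<And>v. w * (v \<bullet> v) \<le> v \<bullet> (A *v v)"
  shows "w \<le> lambda_min A"
proof -
  obtain l where "l \<in> eigenvalues A"
    using ex_eigenvalue_rayleigh_bound[OF A] by blast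
  then have "lambda_min A \<in> eigenvalues A"
    unfolding lambda_min_def using finite_eigenvalues_symmetric[OF A] by (intro Min_in) auto
  then obtain v where v: "v \<noteq> 0" "A *v v = lambda_min A *\<^sub>R v"
    by (auto simp: eigenvalues_def)
  then show ?thesis using w[of v] by simp
qed


section \<open>First-order expansions with Lipschitz derivative\<close>

text \<open>Along the segment from \<open>x\<close> to \<open>y\<close>, the curve \<open>t \<mapsto> f (x + t d) - t f' x d\<close> has speed at most
  \<open>\<beta> t \<parallel>d\<parallel>\<^sup>2\<close>, the derivative of \<open>\<beta> t\<^sup>2 \<parallel>d\<parallel>\<^sup>2 / 2\<close>; the mean value inequality that compares two
  curves by their speeds gives the constant \<open>\<beta> / 2\<close>. The values of \<open>f\<close> are vectors,
  so that the lemma serves both for the map \<open>C\<close> and for the function \<open>s\<close>.\<close>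
lemma quadratic_remainder_bound:
  fixes f :: "'a::real_normed_vector \<Rightarrow> 'b::real_normed_vector"
  assumes f: "\<And>x. (f has_derivative f' x) (at x)"
    and lip: "\<And>x y v. norm (f' y v - f' x v) \<le> \<beta> * norm (y - x) * norm v"
  shows "norm (f y - f x - f' x (y - x)) \<le> \<beta> / 2 * (norm (y - x))\<^sup>2"
proof -
  define d where "d = y - x"
  let ?\<gamma> = "\<lambda>t::real. f (x + t *\<^sub>R d) - t *\<^sub>R f' x d"
  let ?\<phi> = "\<lambda>t::real. \<beta> / 2 * (norm d)\<^sup>2 * t\<^sup>2"
  have \<gamma>: "(?\<gamma> has_vector_derivative (f' (x + t *\<^sub>R d) d - f' x d)) (at t)" for t
  proof -
    have "((\<lambda>t. f (x + t *\<^sub>R d)) has_derivative (\<lambda>u. f' (x + t *\<^sub>R d) (u *\<^sub>R d))) (at t)"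
      by (rule has_derivative_compose[OF _ f]) (auto intro!: derivative_eq_intros)
    then have "((\<lambda>t. f (x + t *\<^sub>R d)) has_vector_derivative f' (x + t *\<^sub>R d) d) (at t)"
      unfolding has_vector_derivative_def
      using f[of "x + t *\<^sub>R d"]
      by (simp add: linear_cmul has_derivative_linear)
    then show ?thesis
      by (auto intro!: derivative_eq_intros)
  qed
  have \<phi>: "(?\<phi> has_vector_derivative \<beta> * (norm d)\<^sup>2 * t) (at t)" for t
    unfolding has_real_derivative_iff_has_vector_derivative[symmetric]
    by (auto intro!: derivative_eq_intros)
  have "norm (?\<gamma> 1 - ?\<gamma> 0) \<le> ?\<phi> 1 - ?\<phi> 0"
  proof (rule differentiable_bound_general)
    show "continuous_on {0..1} ?\<gamma>"
      using \<gamma> by (intro continuous_at_imp_continuous_on ballI)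
        (rule has_vector_derivative_continuous)
    show "continuous_on {0..1} ?\<phi>" by (intro continuous_intros)
    fix t :: real assume t: "0 < t" "t < 1"
    show "norm (f' (x + t *\<^sub>R d) d - f' x d) \<le> \<beta> * (norm d)\<^sup>2 * t"
      using lip[of "x + t *\<^sub>R d" d x] t by (simp add: power2_eq_square algebra_simps)
  qed (use \<gamma> \<phi> in auto)
  then show ?thesis by (simp add: d_def algebra_simps)
qed

text \<open>As \<^const>\<open>grad\<close> is a definite description, a representing vector of the derivative has to be
  exhibited and shown to be unique; its coordinates are the derivatives along the basis.\<close>
lemma GDERIV_grad:
  fixes f :: "'a::euclidean_space \<Rightarrow> real"
  assumes "f differentiable at x"
  shows "GDERIV f x :> grad f x"
proof -
  obtain f' where f': "(f has_derivative f') (at x)"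
    using assms by (auto simp: differentiable_def)
  have lin: "linear f'" using f' by (rule has_derivative_linear)
  have "f' = (\<lambda>v. v \<bullet> (\<Sum>b\<in>Basis. f' b *\<^sub>R b))"
  proof
    fix v
    have "f' v = f' (\<Sum>b\<in>Basis. (v \<bullet> b) *\<^sub>R b)" by (simp add: euclidean_representation)
    also have "\<dots> = v \<bullet> (\<Sum>b\<in>Basis. f' b *\<^sub>R b)"
      using lin by (simp add: linear_sum linear_cmul inner_sum_right mult.commute)
    finally show "f' v = v \<bullet> (\<Sum>b\<in>Basis. f' b *\<^sub>R b)" .
  qed
  then have ex: "GDERIV f x :> (\<Sum>b\<in>Basis. f' b *\<^sub>R b)"
    using f' by (simp add: gderiv_def inner_commute)
  show ?thesis
    unfolding grad_def
  proof (rule theI[where P = "\<lambda>D. GDERIV f x :> D", OF ex])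
    fix D assume "GDERIV f x :> D"
    then have "(\<lambda>v. v \<bullet> D) = (\<lambda>v. v \<bullet> (\<Sum>b\<in>Basis. f' b *\<^sub>R b))"
      using ex unfolding gderiv_def by (rule has_derivative_unique)
    then have "\<forall>v. v \<bullet> D = v \<bullet> (\<Sum>b\<in>Basis. f' b *\<^sub>R b)"
      unfolding fun_eq_iff .
    then show "D = (\<Sum>b\<in>Basis. f' b *\<^sub>R b)"
      by (simp only: vector_eq_ldot)
  qed
qed

lemma C1_on_differentiable: "C1_on f S \<Longrightarrow> x \<in> S \<Longrightarrow> f differentiable at x"
  by (auto simp: C1_on_def differentiable_def)

lemma lipschitz_gradient_upper_bound:
  fixes f :: "'a::euclidean_space \<Rightarrow> real"
  assumes f: "\<And>x. f differentiable at x" and lip: "\<beta>-lipschitz_on UNIV (grad f)"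
  shows "f y \<le> f x + grad f x \<bullet> (y - x) + \<beta> / 2 * (norm (y - x))\<^sup>2"
proof -
  have "norm (f y - f x - (y - x) \<bullet> grad f x) \<le> \<beta> / 2 * (norm (y - x))\<^sup>2"
  proof (rule quadratic_remainder_bound[where f' = "\<lambda>x v. v \<bullet> grad f x"])
    show "(f has_derivative (\<lambda>v. v \<bullet> grad f x)) (at x)" for x
      using GDERIV_grad[OF f] by (simp add: gderiv_def)
    show "norm (v \<bullet> grad f y - v \<bullet> grad f x) \<le> \<beta> * norm (y - x) * norm v" for x y v
    proof -
      have "norm (v \<bullet> grad f y - v \<bullet> grad f x) \<le> norm v * norm (grad f y - grad f x)"
        by (metis Cauchy_Schwarz_ineq2 inner_diff_right real_norm_def)
      also have "\<dots> \<le> norm v * (\<beta> * norm (y - x))"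
        using lipschitz_onD[OF lip, of y x] by (simp add: dist_norm mult_left_mono)
      finally show ?thesis by (simp add: mult_ac)
    qed
  qed
  then show ?thesis unfolding real_norm_def inner_commute[of "y - x"] by linarith
qed

lemma lipschitz_jacobian_remainder:
  fixes C :: "real^'m \<Rightarrow> real^'d"
  assumes C: "\<And>x. C differentiable at x"
    and lip: "\<And>x y. spectral_norm (jacobian C (at x) - jacobian C (at y)) \<le> \<beta> * norm (x - y)"
  shows "norm (C y - C x - jacobian C (at x) *v (y - x)) \<le> \<beta> / 2 * (norm (y - x))\<^sup>2"
proof (rule quadratic_remainder_bound[where f' = "\<lambda>x v. jacobian C (at x) *v v"])
  show "(C has_derivative (\<lambda>v. jacobian C (at x) *v v)) (at x)" for x
    using C jacobian_works by blast
  show "norm (jacobian C (at y) *v v - jacobian C (at x) *v v) \<le> \<beta> * norm (y - x) * norm v"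
    for x y v
  proof -
    let ?D = "jacobian C (at y) - jacobian C (at x)"
    have "norm (?D *v v) \<le> onorm (\<lambda>v. ?D *v v) * norm v"
      by (intro onorm matrix_vector_mul_bounded_linear)
    also have "\<dots> \<le> \<beta> * norm (y - x) * norm v"
      using lip[of y x] by (intro mult_right_mono) (auto simp: spectral_norm_def)
    finally show ?thesis by (simp add: matrix_vector_mult_diff_rdistrib)
  qed
qed

lemma convex_on_compose_affine:
  fixes f :: "'b::real_vector \<Rightarrow> real"
  assumes f: "convex_on UNIV f" and A: "linear A"
  shows "convex_on UNIV (\<lambda>x. f (c + A (x - a)))"
proof (rule convex_onI)
  fix t :: real and x y assume t: "0 < t" "t < 1"
  have "f (c + A ((1 - t) *\<^sub>R x + t *\<^sub>R y - a))
    = f ((1 - t) *\<^sub>R (c + A (x - a)) + t *\<^sub>R (c + A (y - a)))"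
    by (rule arg_cong[where f = f])
      (simp add: linear_add[OF A] linear_diff[OF A] linear_cmul[OF A] algebra_simps)
  also have "\<dots> \<le> (1 - t) * f (c + A (x - a)) + t * f (c + A (y - a))"
    using t by (intro convex_onD[OF f]) auto
  finally show "f (c + A ((1 - t) *\<^sub>R x + t *\<^sub>R y - a)) \<le> \<dots>" .
qed simp

lemma convex_on_ge_linearization:
  fixes f :: "'a::euclidean_space \<Rightarrow> real"
  assumes f: "convex_on UNIV f" and diff: "f differentiable at x"
  shows "grad f x \<bullet> (y - x) \<le> f y - f x"
proof -
  let ?\<gamma> = "\<lambda>t::real. f (x + (t - 0) *\<^sub>R (y - x))"
  have conv: "convex_on UNIV ?\<gamma>"
    by (rule convex_on_compose_affine[OF f]) (simp add: linear_iff algebra_simps)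
  have line: "((\<lambda>t::real. x + (t - 0) *\<^sub>R (y - x)) has_derivative (\<lambda>u. u *\<^sub>R (y - x))) (at 0)"
    by (auto intro!: derivative_eq_intros)
  have "(?\<gamma> has_derivative (\<lambda>u. (u *\<^sub>R (y - x)) \<bullet> grad f x)) (at 0)"
    by (rule has_derivative_compose[OF line]) (use GDERIV_grad[OF diff] in \<open>simp add: gderiv_def\<close>)
  moreover have "(\<lambda>u. (u *\<^sub>R (y - x)) \<bullet> grad f x) = (*) ((y - x) \<bullet> grad f x)"
    by (intro ext) simp
  ultimately have der: "(?\<gamma> has_real_derivative (y - x) \<bullet> grad f x) (at 0)"
    unfolding has_field_derivative_def by metis
  have "?\<gamma> 1 - ?\<gamma> 0 \<ge> (y - x) \<bullet> grad f x * (1 - 0)"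
    by (rule convex_on_imp_above_tangent[OF conv, where c = 0]) (use der in auto)
  then show ?thesis by (simp add: inner_commute)
qed

section \<open>Minimisation of closed convex extended-real functions\<close>

text \<open>The extreme value theorem for lower semicontinuous functions. The sublevel sets at the real
  levels that are reached on \<open>K\<close> are closed and nested, so by compactness they have a common point
  in \<open>K\<close>.\<close>
lemma closed_epigraph_attains_inf:
  fixes f :: "'a::t2_space \<Rightarrow> ereal"
  assumes f: "closed (ereal_epigraph f)" and K: "compact K" "K \<noteq> {}"
  obtains x where "x \<in> K" "\<And>y. y \<in> K \<Longrightarrow> f x \<le> f y"
proof -
  define T where "T = {t::real. \<exists>y\<in>K. f y \<le> ereal t}"
  have "K \<inter> (\<Inter>t\<in>T. {x. f x \<le> ereal t}) \<noteq> {}"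
  proof (rule compact_imp_fip_image[OF K(1)])
    fix t
    have "closed ((\<lambda>x. (x, t)) -` ereal_epigraph f)"
      by (intro closed_vimage f continuous_intros)
    then show "closed {x. f x \<le> ereal t}" by (simp add: ereal_epigraph_def vimage_def)
  next
    fix T' assume T': "finite T'" "T' \<subseteq> T"
    show "K \<inter> (\<Inter>t\<in>T'. {x. f x \<le> ereal t}) \<noteq> {}"
    proof (cases "T' = {}")
      case False
      have "Min T' \<in> T" by (rule subsetD[OF T'(2) Min_in[OF T'(1) False]])
      then obtain y where y: "y \<in> K" "f y \<le> ereal (Min T')" by (auto simp: T_def)
      have "f y \<le> ereal t" if "t \<in> T'" for t
        by (rule order_trans[OF y(2)]) (simp add: Min_le[OF T'(1) that])
      then show ?thesis using y(1) by auto
    qed (use K in auto)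
  qed
  then obtain x where x: "x \<in> K" "\<And>t. t \<in> T \<Longrightarrow> f x \<le> ereal t" by blast
  have "f x \<le> f y" if "y \<in> K" for y
  proof (rule ereal_le_real)
    fix t assume "f y \<le> ereal t"
    with that show "f x \<le> ereal t" by (intro x(2)) (auto simp: T_def)
  qed
  then show ?thesis using x(1) that by blast
qed

lemma mem_epigraph_add_real:
  "(x, t) \<in> ereal_epigraph (\<lambda>x. f x + ereal (\<phi> x)) \<longleftrightarrow> (x, t - \<phi> x) \<in> ereal_epigraph f"
  by (cases "f x") (auto simp: ereal_epigraph_def)

lemma closed_epigraph_add_continuous:
  fixes f :: "'a::topological_space \<Rightarrow> ereal"
  assumes "closed (ereal_epigraph f)" and \<phi>: "continuous_on UNIV \<phi>"
  shows "closed (ereal_epigraph (\<lambda>x. f x + ereal (\<phi> x)))"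
proof -
  have "continuous_on UNIV (\<lambda>z. \<phi> (fst z) :: real)"
    by (rule continuous_on_compose2[OF \<phi>]) (auto intro!: continuous_intros)
  then have "closed ((\<lambda>z. (fst z, snd z - \<phi> (fst z))) -` ereal_epigraph f)"
    by (intro closed_vimage assms continuous_intros)
  also have "(\<lambda>z. (fst z, snd z - \<phi> (fst z))) -` ereal_epigraph f
      = ereal_epigraph (\<lambda>x. f x + ereal (\<phi> x))"
    by (auto simp: mem_epigraph_add_real)
  finally show ?thesis .
qed

lemma convex_epigraph_add_convex:
  assumes f: "convex (ereal_epigraph f)" and \<phi>: "convex_on UNIV \<phi>"
  shows "convex (ereal_epigraph (\<lambda>x. f x + ereal (\<phi> x)))"
proof (rule convexI)
  fix y z and u v :: real
  assume yz: "y \<in> ereal_epigraph (\<lambda>x. f x + ereal (\<phi> x))" "z \<in> ereal_epigraph (\<lambda>x. f x + ereal (\<phi> x))"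
    and uv: "0 \<le> u" "0 \<le> v" "u + v = 1"
  obtain a s b t where yz_eq: "y = (a, s)" "z = (b, t)" by (cases y, cases z)
  have "u *\<^sub>R (a, s - \<phi> a) + v *\<^sub>R (b, t - \<phi> b) \<in> ereal_epigraph f"
    using yz uv by (intro convexD[OF f]) (simp_all add: yz_eq mem_epigraph_add_real)
  then have "f (u *\<^sub>R a + v *\<^sub>R b) \<le> ereal (u * (s - \<phi> a) + v * (t - \<phi> b))"
    by (simp add: ereal_epigraph_def)
  also have "\<dots> \<le> ereal (u * s + v * t - \<phi> (u *\<^sub>R a + v *\<^sub>R b))"
    using \<phi> uv unfolding convex_on_def by (simp add: algebra_simps)
  finally show "u *\<^sub>R y + v *\<^sub>R z \<in> ereal_epigraph (\<lambda>x. f x + ereal (\<phi> x))"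
    by (simp add: yz_eq mem_epigraph_add_real) (simp add: ereal_epigraph_def)
qed

lemma convex_epigraph_segment:
  assumes "convex (ereal_epigraph f)" "f x = ereal a" "f y = ereal b" "0 \<le> t" "t \<le> 1"
  shows "f ((1 - t) *\<^sub>R x + t *\<^sub>R y) \<le> ereal ((1 - t) * a + t * b)"
proof -
  have "(1 - t) *\<^sub>R (x, a) + t *\<^sub>R (y, b) \<in> ereal_epigraph f"
    using assms by (intro convexD) (auto simp: ereal_epigraph_def)
  then show ?thesis by (simp add: ereal_epigraph_def)
qed

text \<open>A closed convex function decreases at most linearly away from a point \<open>a\<close> of its domain: if
  \<open>m\<close> is its minimum over the unit ball around \<open>a\<close>, convexity along the ray through \<open>x\<close> gives
  \<open>f x \<ge> f a - n (f a - m)\<close> at distance \<open>n \<ge> 1\<close>. A quadratically growing perturbation beats this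
  linear decrease, so points outside a large enough ball do not matter for the minimisation.\<close>
lemma ex_minimizer_of_quadratic_growth:
  fixes f :: "'a::euclidean_space \<Rightarrow> ereal" and q :: "'a \<Rightarrow> real"
  assumes f: "closed (ereal_epigraph f)" "convex (ereal_epigraph f)" "\<And>x. f x \<noteq> - \<infinity>"
    and a: "f a < \<infinity>"
    and q: "continuous_on UNIV q" "q a = 0" "\<And>x. w / 2 * (norm (x - a))\<^sup>2 \<le> q x" and w: "w > 0"
  obtains p where "\<And>x. f p + ereal (q p) \<le> f x + ereal (q x)"
proof -
  obtain fa where fa: "f a = ereal fa" using a f(3)[of a] by (cases "f a") auto
  obtain y where y: "\<And>x. x \<in> cball a 1 \<Longrightarrow> f y \<le> f x"
    by (rule closed_epigraph_attains_inf[OF f(1), of "cball a 1"]) auto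
  then have "f y \<le> ereal fa" using fa by (metis centre_in_cball zero_le_one)
  then obtain m where m: "f y = ereal m" "m \<le> fa" using f(3)[of y] by (cases "f y") auto
  \<comment> \<open>Beyond this radius \<open>w n\<^sup>2 / 2\<close> exceeds \<open>n (f a - m)\<close>.\<close>
  define R where "R = 1 + 2 * (fa - m) / w"
  have R: "R \<ge> 1" using w m by (simp add: R_def)
  obtain p where p: "\<And>x. x \<in> cball a R \<Longrightarrow> f p + ereal (q p) \<le> f x + ereal (q x)"
    using R by (rule_tac closed_epigraph_attains_inf[OF closed_epigraph_add_continuous[OF f(1) q(1)],
          of "cball a R"]) auto
  have "f p + ereal (q p) \<le> f x + ereal (q x)" for x
  proof (cases "x \<in> cball a R \<or> f x = \<infinity>")
    case True
    then show ?thesis using p by fastforce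
  next
    case False
    then obtain b where b: "f x = ereal b" using f(3)[of x] by (cases "f x") auto
    define n where "n = norm (x - a)"
    \<comment> \<open>The point where the segment from \<open>a\<close> to \<open>x\<close> leaves the unit ball.\<close>
    define z where "z = (1 - 1 / n) *\<^sub>R a + (1 / n) *\<^sub>R x"
    have n: "n > R" using False by (simp add: n_def dist_norm norm_minus_commute)
    have "z - a = (1 / n) *\<^sub>R (x - a)" by (simp add: z_def algebra_simps)
    then have "norm (z - a) = 1" using n R by (simp add: n_def[symmetric])
    then have "ereal m \<le> f z" using y[of z] m by (simp add: dist_norm norm_minus_commute)
    also have "\<dots> \<le> ereal ((1 - 1 / n) * fa + 1 / n * b)"
      unfolding z_def using n R by (intro convex_epigraph_segment f fa b) auto
    finally have "m \<le> (1 - 1 / n) * fa + 1 / n * b" by simp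
    then have "n * m \<le> n * ((1 - 1 / n) * fa + 1 / n * b)" using n R by simp
    also have "\<dots> = (n - 1) * fa + b" using n R by (simp add: field_simps)
    finally have 1: "fa - n * (fa - m) \<le> b" by (simp add: algebra_simps)
    have "2 * (fa - m) / w < n" using n by (simp add: R_def)
    then have "fa - m \<le> w / 2 * n" using w by (simp add: field_simps)
    then have "n * (fa - m) \<le> n * (w / 2 * n)" using n R by (intro mult_left_mono) auto
    also have "\<dots> \<le> q x" using q(3)[of x] by (simp add: n_def power2_eq_square mult_ac)
    finally have "fa \<le> b + q x" using 1 by simp
    then have "f a + ereal (q a) \<le> f x + ereal (q x)" by (simp add: fa b q)
    then show ?thesis using p[of a] R by (simp add: order_trans)
  qed
  then show ?thesis using that by blast
qed

text \<open>Comparing the values at \<open>p\<close> and \<open>a\<close> would give only half of the quadratic term. The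
  full term comes from strong convexity: minimality is tested at \<open>(1 - t) p + t a\<close>, where the
  perturbation shrinks by the factor \<open>(1 - t)\<^sup>2\<close>, the resulting inequality is divided by \<open>t\<close>, and
  \<open>t\<close> tends to \<open>0\<close>.\<close>
lemma minimizer_of_quadratic_perturbation_decrease:
  fixes f :: "real^'m \<Rightarrow> ereal" and Q :: "real^'m^'m"
  assumes f: "convex (ereal_epigraph f)" and fa: "f a = ereal fa" and fp: "f p = ereal fp"
    and min: "\<And>x. f p + ereal (1/2 * ((p - a) \<bullet> (Q *v (p - a))))
                \<le> f x + ereal (1/2 * ((x - a) \<bullet> (Q *v (x - a))))"
  shows "fp + (p - a) \<bullet> (Q *v (p - a)) \<le> fa"
proof -
  define c where "c = (p - a) \<bullet> (Q *v (p - a))"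
  have step: "fp + (1 - t / 2) * c \<le> fa" if t: "0 < t" "t < 1" for t
  proof -
    define x where "x = (1 - t) *\<^sub>R p + t *\<^sub>R a"
    have "x - a = (1 - t) *\<^sub>R (p - a)" by (simp add: x_def algebra_simps)
    then have q: "(x - a) \<bullet> (Q *v (x - a)) = (1 - t)\<^sup>2 * c"
      by (simp add: c_def matrix_vector_mult_scaleR power2_eq_square)
    have "ereal (fp + 1/2 * c) \<le> f x + ereal (1/2 * ((1 - t)\<^sup>2 * c))"
      using min[of x] by (simp add: q fp flip: c_def)
    also have "\<dots> \<le> ereal ((1 - t) * fp + t * fa) + ereal (1/2 * ((1 - t)\<^sup>2 * c))"
      unfolding x_def using t by (intro add_right_mono convex_epigraph_segment f fp fa) auto
    finally have "t * (fp + (1 - t / 2) * c) \<le> t * fa"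
      by (simp add: power2_eq_square algebra_simps)
    then show ?thesis using t by simp
  qed
  have "((\<lambda>t. fp + (1 - t / 2) * c) \<longlongrightarrow> fp + (1 - 0 / 2) * c) (at_right 0)"
    by (intro tendsto_intros) simp
  moreover have "eventually (\<lambda>t. fp + (1 - t / 2) * c \<le> fa) (at_right (0::real))"
    using step by (auto simp: eventually_at_right_field intro!: exI[of _ 1])
  ultimately have "fp + (1 - 0 / 2) * c \<le> fa"
    by (rule tendsto_upperbound) simp
  then show ?thesis by (simp add: c_def)
qed

section \<open>The proximal model and the acceptance test\<close>

text \<open>The model without the summand \<open>g\<close>. It is real-valued, which confines extended-real arithmetic
  to \<open>g\<close> alone.\<close>
definition model_finite_part ::
  "(real^'d \<Rightarrow> real) \<Rightarrow> (real^'m \<Rightarrow> real^'d) \<Rightarrow> (real^'n \<Rightarrow> real) \<Rightarrow>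
   ('n \<Rightarrow> real^'m \<Rightarrow> real) \<Rightarrow> real^'m \<Rightarrow> real^'m \<Rightarrow> real" where
  "model_finite_part h C s r xk x =
     h (C xk + jacobian C (at xk) *v (x - xk)) + s (Rmap r xk)
     + (\<Sum>i\<in>UNIV. grad s (Rmap r xk) $ i * Phi s r i x xk)"

lemma model_eq: "model g h C s r xk x = g x + ereal (model_finite_part h C s r xk x)"
  by (cases "g x") (simp_all add: model_def model_finite_part_def)

lemma objective_eq: "objective g h C s r x = g x + ereal (h (C x) + s (Rmap r x))"
  by (cases "g x") (simp_all add: objective_def)

lemma model_finite_part_at_center:
  "model_finite_part h C s r xk xk = h (C xk) + s (Rmap r xk)"
proof -
  have "Phi s r i xk xk = 0" for i by (simp add: Phi_def)
  then show ?thesis by (simp add: model_finite_part_def)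
qed

lemma convex_on_sum_functions:
  assumes "finite I" "convex S" "\<And>i. i \<in> I \<Longrightarrow> convex_on S (F i)"
  shows "convex_on S (\<lambda>x. \<Sum>i\<in>I. F i x)"
  using assms(1,3)
proof (induction I)
  case (insert i I)
  then have "convex_on S (\<lambda>x. F i x + (\<Sum>i\<in>I. F i x))" by (intro convex_on_add) auto
  then show ?case using insert.hyps by simp
qed (simp add: convex_on_const assms(2))

text \<open>A component \<open>r i\<close> enters the model through its convex difference exactly when its weight is
  nonnegative, and through an affine function otherwise, so each term of the sum is convex.\<close>
lemma model_finite_part_convex:
  assumes h: "convex_on UNIV h" and r: "\<And>i. convex_on UNIV (r i)"
  shows "convex_on UNIV (model_finite_part h C s r xk)"
proof -
  have "convex_on UNIV (\<lambda>x. grad s (Rmap r xk) $ i * Phi s r i x xk)" for i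
  proof (cases "grad s (Rmap r xk) $ i \<ge> 0")
    case True
    have "convex_on UNIV (\<lambda>x. r i x + - r i xk)"
      by (intro convex_on_add r) (simp add: convex_on_const)
    then show ?thesis
      using True by (simp add: Phi_def convex_on_cmul)
  next
    case False
    let ?c = "grad s (Rmap r xk) $ i" and ?v = "grad (r i) xk"
    have eq: "?c * (?v \<bullet> ((1 - t) *\<^sub>R x + t *\<^sub>R y - xk))
        = (1 - t) * (?c * (?v \<bullet> (x - xk))) + t * (?c * (?v \<bullet> (y - xk)))" for t x y
      by (simp add: inner_diff_right inner_add_right algebra_simps)
    have "convex_on UNIV (\<lambda>x. ?c * (?v \<bullet> (x - xk)))"
      by (rule convex_onI) (simp_all only: eq order_refl convex_UNIV)
    then show ?thesis
      using False by (simp add: Phi_def)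
  qed
  then have "convex_on UNIV (\<lambda>x. \<Sum>i\<in>UNIV. grad s (Rmap r xk) $ i * Phi s r i x xk)"
    by (intro convex_on_sum_functions) auto
  moreover have "convex_on UNIV (\<lambda>x. h (C xk + jacobian C (at xk) *v (x - xk)))"
    by (rule convex_on_compose_affine[OF h]) simp
  ultimately show ?thesis
    unfolding model_finite_part_def by (intro convex_on_add) (simp_all add: convex_on_const)
qed

lemma model_finite_part_continuous:
  assumes h: "continuous_on UNIV h" and r: "\<And>i. continuous_on UNIV (r i)"
  shows "continuous_on UNIV (model_finite_part h C s r xk)"
proof -
  have "continuous_on UNIV (\<lambda>x. h (C xk + jacobian C (at xk) *v (x - xk)))"
    by (rule continuous_on_compose2[OF h])
      (auto intro!: continuous_intros matrix_vector_mult_linear_continuous_on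
          continuous_on_compose2[OF matrix_vector_mult_linear_continuous_on])
  moreover have "continuous_on UNIV (\<lambda>x. Phi s r i x xk)" for i
    unfolding Phi_def
    by (cases "grad s (Rmap r xk) $ i \<ge> 0") (auto intro!: continuous_intros r)
  ultimately show ?thesis
    unfolding model_finite_part_def by (auto intro!: continuous_intros)
qed

text \<open>The error of the model has three sources. Replacing \<open>C\<close> by its linearization inside \<open>h\<close> costs
  \<open>L_h \<beta>_C / 2\<close>; linearizing \<open>s\<close> at \<open>R xk\<close> costs \<open>\<beta>_s / 2\<close> times the squared increment of \<open>R\<close>, which is at
  most \<open>(norm L_r)\<^sup>2\<close> times that of \<open>x\<close>. The third replacement, of \<open>r i\<close> by its linearization, occurs only for
  negative weights; a convex function lies above its linearization, so it costs nothing.\<close>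
lemma objective_le_model:
  fixes h :: "real^'d \<Rightarrow> real" and C :: "real^'m \<Rightarrow> real^'d"
    and s :: "real^'n \<Rightarrow> real" and r :: "'n \<Rightarrow> real^'m \<Rightarrow> real"
  assumes C: "\<And>x. C differentiable at x" and s: "\<And>x. s differentiable at x"
    and r: "\<And>i. convex_on UNIV (r i)"
    and r_smooth: "\<And>i. grad s (Rmap r xk) $ i < 0 \<Longrightarrow> r i differentiable at xk"
    and h_lipschitz: "L_h-lipschitz_on UNIV h"
    and C_lipschitz:
      "\<And>x y. spectral_norm (jacobian C (at x) - jacobian C (at y)) \<le> \<beta>_C * norm (x - y)"
    and s_lipschitz: "\<beta>_s-lipschitz_on UNIV (grad s)"
    and r_lipschitz: "\<And>i. (L_r $ i)-lipschitz_on UNIV (r i)"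
  shows "h (C x) + s (Rmap r x)
    \<le> model_finite_part h C s r xk x
      + (L_h * \<beta>_C + (norm L_r)\<^sup>2 * \<beta>_s) / 2 * (norm (x - xk))\<^sup>2"
proof -
  let ?d = "norm (x - xk)" and ?y = "C xk + jacobian C (at xk) *v (x - xk)"
  let ?G = "grad s (Rmap r xk)"
  have "h (C x) - h ?y \<le> L_h * norm (C x - ?y)"
    using lipschitz_onD[OF h_lipschitz, of "C x" ?y] by (simp add: dist_norm abs_le_iff)
  also have "norm (C x - ?y) \<le> \<beta>_C / 2 * ?d\<^sup>2"
    using lipschitz_jacobian_remainder[OF C C_lipschitz, of x xk] by (simp add: algebra_simps)
  finally have 1: "h (C x) \<le> h ?y + L_h * \<beta>_C / 2 * ?d\<^sup>2"
    using lipschitz_on_nonneg[OF h_lipschitz] by (simp add: mult_left_mono)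
  have "norm (Rmap r x - Rmap r xk) \<le> norm (?d *\<^sub>R L_r)"
  proof (rule norm_le_componentwise_cart)
    show "norm ((Rmap r x - Rmap r xk) $ i) \<le> norm ((?d *\<^sub>R L_r) $ i)" for i
      using lipschitz_onD[OF r_lipschitz[of i], of x xk] lipschitz_on_nonneg[OF r_lipschitz[of i]]
      by (simp add: Rmap_def dist_norm abs_mult mult.commute)
  qed
  then have "(norm (Rmap r x - Rmap r xk))\<^sup>2 \<le> (norm (?d *\<^sub>R L_r))\<^sup>2"
    by (rule power_mono) simp
  then have "\<beta>_s / 2 * (norm (Rmap r x - Rmap r xk))\<^sup>2 \<le> \<beta>_s / 2 * (norm (?d *\<^sub>R L_r))\<^sup>2"
    using lipschitz_on_nonneg[OF s_lipschitz] by (intro mult_left_mono) auto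
  then have 2: "s (Rmap r x) \<le> s (Rmap r xk) + ?G \<bullet> (Rmap r x - Rmap r xk)
      + (norm L_r)\<^sup>2 * \<beta>_s / 2 * ?d\<^sup>2"
    using lipschitz_gradient_upper_bound[OF s s_lipschitz, of "Rmap r x" "Rmap r xk"]
    by (simp add: power_mult_distrib mult_ac)
  have "?G \<bullet> (Rmap r x - Rmap r xk) = (\<Sum>i\<in>UNIV. ?G $ i * (r i x - r i xk))"
    by (simp add: inner_vec_def Rmap_def)
  also have "\<dots> \<le> (\<Sum>i\<in>UNIV. ?G $ i * Phi s r i x xk)"
  proof (rule sum_mono)
    fix i
    show "?G $ i * (r i x - r i xk) \<le> ?G $ i * Phi s r i x xk"
    proof (cases "?G $ i \<ge> 0")
      case False
      then have "grad (r i) xk \<bullet> (x - xk) \<le> r i x - r i xk"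
        by (intro convex_on_ge_linearization r r_smooth) simp
      then show ?thesis using False by (simp add: Phi_def mult_left_mono_neg)
    qed (simp add: Phi_def)
  qed
  finally show ?thesis
    using 1 2 unfolding model_finite_part_def
    by (simp add: add_divide_distrib distrib_right)
qed

text \<open>Let \<open>c\<close> be the value of the quadratic form of \<open>Q\<close> at the trial step. Strong convexity gives
  \<open>Pred \<ge> c / 2\<close>, and the upper bound on the objective gives
  \<open>Act \<ge> Pred + c / 2 - L \<parallel>p - xk\<parallel>\<^sup>2 / 2\<close>. Hence
  \<open>Act - \<alpha>1 Pred \<ge> (1 - \<alpha>1) c / 2 + c / 2 - L \<parallel>p - xk\<parallel>\<^sup>2 / 2\<close>, which is nonnegative as soon as
  \<open>c \<ge> L / (2 - \<alpha>1) \<parallel>p - xk\<parallel>\<^sup>2\<close>. Strict positivity of the weight \<open>w\<close> is what makes the trial point a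
  genuine minimizer.\<close>
lemma accepted_if_curvature_dominates:
  fixes g :: "real^'m \<Rightarrow> ereal" and Q :: "real^'m^'m"
  assumes g: "closed (ereal_epigraph g)" "convex (ereal_epigraph g)" "\<And>x. g x \<noteq> - \<infinity>"
    and gk: "g xk < \<infinity>"
    and cont: "continuous_on UNIV (model_finite_part h C s r xk)"
    and conv: "convex_on UNIV (model_finite_part h C s r xk)"
    and upper: "\<And>x. h (C x) + s (Rmap r x)
                  \<le> model_finite_part h C s r xk x + L / 2 * (norm (x - xk))\<^sup>2"
    and w: "w > 0" "\<And>v. w * (v \<bullet> v) \<le> v \<bullet> (Q *v v)"
    and Q: "\<And>v. L / (2 - \<alpha>1) * (v \<bullet> v) \<le> v \<bullet> (Q *v v)"
    and \<alpha>1: "\<alpha>1 < 1"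
    and Pred: "Pred g h C s r xk Q \<noteq> 0"
  shows "accepted g h C s r \<alpha>1 xk Q"
proof -
  define \<phi> where "\<phi> = model_finite_part h C s r xk"
  define f where "f = (\<lambda>x. g x + ereal (\<phi> x))"
  define q where "q x = 1/2 * ((x - xk) \<bullet> (Q *v (x - xk)))" for x
  define p where "p = trial_point g h C s r xk Q"
  have prox: "prox_model g h C s r xk Q x = f x + ereal (q x)" for x
    by (simp add: prox_model_def model_eq f_def \<phi>_def q_def)
  have f: "closed (ereal_epigraph f)" "convex (ereal_epigraph f)"
    unfolding f_def \<phi>_def
    by (rule closed_epigraph_add_continuous[OF g(1) cont] convex_epigraph_add_convex[OF g(2) conv])+
  have f_proper: "f x \<noteq> - \<infinity>" for x using g(3)[of x] by (cases "g x") (auto simp: f_def)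
  have "f xk < \<infinity>" using gk by (simp add: f_def)
  have q_cont: "continuous_on UNIV q" unfolding q_def
    by (auto intro!: continuous_intros continuous_on_compose2[OF matrix_vector_mult_linear_continuous_on])
  have "w / 2 * (norm (x - xk))\<^sup>2 \<le> q x" for x
    using w(2)[of "x - xk"] by (simp add: q_def power2_norm_eq_inner)
  then obtain p0 where "\<And>x. f p0 + ereal (q p0) \<le> f x + ereal (q x)"
    using ex_minimizer_of_quadratic_growth[OF f f_proper \<open>f xk < \<infinity>\<close> q_cont _ _ w(1)]
    by (auto simp: q_def)
  then have p: "f p + ereal (q p) \<le> f x + ereal (q x)" for x
    unfolding p_def trial_point_def prox[abs_def]
    by (rule_tac arg_minI[where x = p0]) (auto simp: not_less)
  obtain fk where fk: "f xk = ereal fk" using \<open>f xk < \<infinity>\<close> f_proper[of xk] by (cases "f xk") auto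
  \<comment> \<open>The proximal model at the trial point is at most its value at \<open>xk\<close>, so everything below is real.\<close>
  have "f p + ereal (q p) \<le> ereal fk" using p[of xk] by (simp add: fk q_def)
  then obtain gp where gp: "g p = ereal gp" using g(3)[of p] by (cases "g p") (auto simp: f_def)
  define fp where "fp = gp + \<phi> p"
  have fp: "f p = ereal fp" by (simp add: f_def gp fp_def)
  define c where "c = (p - xk) \<bullet> (Q *v (p - xk))"
  let ?Fp = "gp + (h (C p) + s (Rmap r p))"
  have Fk: "objective g h C s r xk = ereal fk"
    using fk by (simp add: objective_eq f_def \<phi>_def model_finite_part_at_center)
  have Pred_eq: "Pred g h C s r xk Q = ereal (fk - (fp + c / 2))"
    unfolding Pred_def Fk p_def[symmetric] by (simp add: prox fp q_def c_def)
  have Act_eq: "Act g h C s r xk Q = ereal (fk - ?Fp)"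
    unfolding Act_def Fk p_def[symmetric] by (simp add: objective_eq gp)
  have decrease: "fp + c \<le> fk"
    unfolding c_def
    by (rule minimizer_of_quadratic_perturbation_decrease[OF f(2) fk fp]) (use p in \<open>simp add: q_def\<close>)
  have "c \<ge> 0" unfolding c_def using w(1) w(2)[of "p - xk"]
    by (meson inner_ge_zero less_imp_le mult_nonneg_nonneg order_trans)
  then have pos: "fk - (fp + c / 2) > 0" using decrease Pred Pred_eq by (simp add: zero_ereal_def)
  have "L * (norm (p - xk))\<^sup>2 \<le> (2 - \<alpha>1) * c"
    using Q[of "p - xk"] \<alpha>1 by (simp add: power2_norm_eq_inner c_def[symmetric] field_simps)
  then have "?Fp \<le> fp + (2 - \<alpha>1) * c / 2"
    using upper[of p] by (simp add: fp_def \<phi>_def)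
  moreover have "(1 - \<alpha>1) * (fk - (fp + c / 2)) \<ge> (1 - \<alpha>1) * (c / 2)"
    using decrease \<alpha>1 by (intro mult_left_mono) auto
  ultimately have "\<alpha>1 * (fk - (fp + c / 2)) \<le> fk - ?Fp"
    by (simp add: algebra_simps diff_divide_distrib)
  then have "\<alpha>1 \<le> (fk - ?Fp) / (fk - (fp + c / 2))"
    using pos by (simp add: pos_le_divide_eq)
  then show ?thesis
    unfolding accepted_def Pred_eq Act_eq using pos by (simp add: zero_ereal_def)
qed

section \<open>The weights of the inner loop\<close>

lemma loop_weight_eq: "loop_weight \<nu> \<mu> j = \<nu> ^ j * \<mu>"
  by (induction j) auto

lemma loop_weight_ge_at_rejection_bound:
  assumes "0 \<le> \<psi>" "1 < \<nu>" "0 < \<mu>"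
  shows "\<psi> \<le> loop_weight \<nu> \<mu> (rejection_bound \<psi> \<mu> \<nu>)"
proof (cases "\<psi> = 0")
  case False
  then have \<psi>: "\<psi> > 0" using assms by simp
  define K where "K = rejection_bound \<psi> \<mu> \<nu>"
  have "ln (\<psi> / \<mu>) / ln \<nu> \<le> real K"
    unfolding K_def rejection_bound_def using \<psi> by simp linarith
  then have "ln (\<psi> / \<mu>) \<le> real K * ln \<nu>" using assms by (simp add: pos_divide_le_eq)
  also have "\<dots> = ln (\<nu> ^ K)" using assms by (simp add: ln_realpow)
  finally have "\<psi> / \<mu> \<le> \<nu> ^ K" using assms \<psi> by simp
  then show ?thesis using assms by (simp add: loop_weight_eq pos_divide_le_eq flip: K_def)
qed (use assms in \<open>simp add: loop_weight_eq\<close>)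

lemma loop_metric_symmetric: "psd H \<Longrightarrow> transpose (loop_metric \<nu> \<mu> H j) = loop_metric \<nu> \<mu> H j"
  by (auto simp: psd_def loop_metric_def transpose_def mat_def vec_eq_iff)

lemma loop_metric_ge_weight:
  assumes "psd H"
  shows "loop_weight \<nu> \<mu> j * (v \<bullet> v) \<le> v \<bullet> (loop_metric \<nu> \<mu> H j *v v)"
  using assms by (simp add: loop_metric_def psd_def matrix_vector_mult_add_rdistrib
      scaleR_matrix_vector_assoc[symmetric] inner_add_right)

text \<open>The trials preceding the first one that is not rejected are all rejected, so their number is the
  supremum in the definition of \<^const>\<open>num_rejections\<close>; any index whose trial is not rejected bounds it.\<close>
lemma num_rejections_first_nonrejected:
  assumes "\<not> rejected g h C s r \<alpha>1 xk (loop_metric \<nu> \<mu> H K)"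
  obtains N where "N \<le> K" "num_rejections g h C s r \<alpha>1 \<nu> \<mu> H xk = enat N"
    "\<not> rejected g h C s r \<alpha>1 xk (loop_metric \<nu> \<mu> H N)"
proof -
  let ?rej = "\<lambda>j. rejected g h C s r \<alpha>1 xk (loop_metric \<nu> \<mu> H j)"
  define N where "N = (LEAST j. \<not> ?rej j)"
  have N: "\<not> ?rej N" unfolding N_def by (rule LeastI[where P = "\<lambda>j. \<not> ?rej j", OF assms])
  have "N \<le> K" unfolding N_def by (rule Least_le[where P = "\<lambda>j. \<not> ?rej j", OF assms])
  have before: "?rej j" if "j < N" for j using not_less_Least[OF that[unfolded N_def]] by simp
  have "num_rejections g h C s r \<alpha>1 \<nu> \<mu> H xk = enat N"
    unfolding num_rejections_def
  proof (rule antisym)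
    show "(SUP N\<in>{N. \<forall>j<N. ?rej j}. enat N) \<le> enat N"
      using N by (intro SUP_least) (auto simp: not_le[symmetric])
    show "enat N \<le> (SUP N\<in>{N. \<forall>j<N. ?rej j}. enat N)"
      using before by (intro SUP_upper) auto
  qed
  then show ?thesis using \<open>N \<le> K\<close> N that by blast
qed

theorem lemma3p3:
  fixes g :: "real^'m \<Rightarrow> ereal"
    and h :: "real^'d \<Rightarrow> real"
    and C :: "real^'m \<Rightarrow> real^'d"
    and s :: "real^'n \<Rightarrow> real"
    and r :: "'n \<Rightarrow> real^'m \<Rightarrow> real"
    and L_r :: "real^'n"
    and \<beta>_r :: "'n \<Rightarrow> real"
    and L_h \<beta>_C \<beta>_s L_s L_R L_U \<psi> \<alpha>1 \<nu> \<mu> :: real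
    and x0 xk :: "real^'m"
    and H :: "real^'m^'m"
  assumes g: "proper_fun g" "closed (ereal_epigraph g)" "convex (ereal_epigraph g)"
    and h: "closed (epigraph UNIV h)" "convex_on UNIV h"
    and C: "C1_on C UNIV"
    and s: "C1_on s UNIV"
    and r: "\<And>i. closed (epigraph UNIV (r i))" "\<And>i. convex_on UNIV (r i)"
    and monotone_or_smooth:
      "\<And>x. x \<in> effective_domain (objective g h C s r) \<Longrightarrow>
         \<exists>W. open W \<and> Rmap r x \<in> W \<and>
           (\<forall>i. \<not> (\<exists>U. open U \<and> x \<in> U \<and> C1_on (r i) U) \<longrightarrow> (\<forall>z\<in>W. grad s z $ i \<ge> 0))"
    and x0: "x0 \<in> effective_domain (objective g h C s r)"
    and level_set: "initial_level_set (objective g h C s r) x0 \<noteq> {}"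
      "compact (initial_level_set (objective g h C s r) x0)"
    and h_lipschitz: "L_h-lipschitz_on UNIV h"
    and C_lipschitz:
      "\<And>x y. spectral_norm (jacobian C (at x) - jacobian C (at y)) \<le> \<beta>_C * norm (x - y)"
    and s_lipschitz: "\<beta>_s-lipschitz_on UNIV (grad s)"
    and r_lipschitz: "\<And>i. (L_r $ i)-lipschitz_on UNIV (r i)"
    and L_R: "L_R = norm L_r"
    and negative_indices:
      "{i. \<exists>x \<in> initial_level_set (objective g h C s r) x0. grad s (Rmap r x) $ i < 0} \<noteq> {} \<Longrightarrow>
         (\<forall>y \<in> Rmap r ` {x. objective g h C s r x \<le> objective g h C s r x0}.
            norm (grad s y) \<le> L_s) \<and>
         (\<forall>i \<in> {i. \<exists>x \<in> initial_level_set (objective g h C s r) x0. grad s (Rmap r x) $ i < 0}.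
            C1_on (r i) UNIV \<and> (\<beta>_r i)-lipschitz_on UNIV (grad (r i)))"
    and \<alpha>1: "0 < \<alpha>1" "\<alpha>1 < 1"
    and \<nu>: "1 < \<nu>"
    and \<mu>: "0 < \<mu>"
    and xk: "xk \<in> initial_level_set (objective g h C s r) x0"
    and H: "psd H"
    and L_U: "L_U = L_h * \<beta>_C + L_R\<^sup>2 * \<beta>_s"
    and \<psi>: "\<psi> = L_U / (2 - \<alpha>1)"
  shows "num_rejections g h C s r \<alpha>1 \<nu> \<mu> H xk \<le> enat (rejection_bound \<psi> \<mu> \<nu>)
    \<and> lambda_min (loop_metric \<nu> \<mu> H (rejection_bound \<psi> \<mu> \<nu>)) \<ge> \<psi>
    \<and> (\<forall>j. lambda_min (loop_metric \<nu> \<mu> H j) \<ge> \<psi> \<and> Pred g h C s r xk (loop_metric \<nu> \<mu> H j) \<noteq> 0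
          \<longrightarrow> accepted g h C s r \<alpha>1 xk (loop_metric \<nu> \<mu> H j))
    \<and> (\<exists>N. num_rejections g h C s r \<alpha>1 \<nu> \<mu> H xk = enat N
          \<and> (Pred g h C s r xk (loop_metric \<nu> \<mu> H N) \<noteq> 0
             \<longrightarrow> accepted g h C s r \<alpha>1 xk (loop_metric \<nu> \<mu> H N)))
    \<and> (\<mu> \<ge> \<psi> \<longrightarrow> num_rejections g h C s r \<alpha>1 \<nu> \<mu> H xk = 0)"
proof -
  let ?F = "objective g h C s r" and ?Q = "loop_metric \<nu> \<mu> H"
  let ?K = "rejection_bound \<psi> \<mu> \<nu>"
  have C': "\<And>x. C differentiable at x" and s': "\<And>x. s differentiable at x"
    using C s C1_on_differentiable by blast+
  have r_smooth: "r i differentiable at xk" if "grad s (Rmap r xk) $ i < 0" for i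
    using negative_indices that xk by (blast intro: C1_on_differentiable)
  have upper: "h (C x) + s (Rmap r x)
      \<le> model_finite_part h C s r xk x + L_U / 2 * (norm (x - xk))\<^sup>2" for x
    unfolding L_U L_R
    by (rule objective_le_model[OF C' s' r(2) r_smooth h_lipschitz C_lipschitz s_lipschitz
          r_lipschitz])
  have g_proper: "g x \<noteq> - \<infinity>" for x using g(1) by (simp add: proper_fun_def)
  have "?F xk < \<infinity>" using xk by (simp add: initial_level_set_def effective_domain_def)
  then have gk: "g xk < \<infinity>" by (cases "g xk") (auto simp: objective_eq)
  have conv: "convex_on UNIV (model_finite_part h C s r xk)"
    by (rule model_finite_part_convex[OF h(2) r(2)])
  have cont: "continuous_on UNIV (model_finite_part h C s r xk)"
    by (rule model_finite_part_continuous)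
      (use h_lipschitz r_lipschitz lipschitz_on_continuous_on in blast)+
  have sym: "transpose (?Q j) = ?Q j" for j by (rule loop_metric_symmetric[OF H])
  have weight_le: "loop_weight \<nu> \<mu> j \<le> lambda_min (?Q j)" for j
    by (rule lambda_min_geI[OF sym loop_metric_ge_weight[OF H]])
  have accept: "accepted g h C s r \<alpha>1 xk (?Q j)"
    if j: "\<psi> \<le> lambda_min (?Q j)" and Pred: "Pred g h C s r xk (?Q j) \<noteq> 0" for j
  proof (rule accepted_if_curvature_dominates[OF g(2,3) g_proper gk cont conv upper
        _ loop_metric_ge_weight[OF H] _ \<alpha>1(2) Pred])
    show "0 < loop_weight \<nu> \<mu> j" using \<mu> \<nu> by (simp add: loop_weight_eq)
    show "L_U / (2 - \<alpha>1) * (v \<bullet> v) \<le> v \<bullet> (?Q j *v v)" for v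
      using mult_right_mono[OF j inner_ge_zero[of v]] lambda_min_le_rayleigh[OF sym, of j v]
      by (simp add: \<psi>)
  qed
  then have not_rejected: "\<not> rejected g h C s r \<alpha>1 xk (?Q j)" if "\<psi> \<le> lambda_min (?Q j)" for j
    using that by (auto simp: accepted_def rejected_def not_le[symmetric])
  have "\<psi> \<ge> 0"
  proof -
    \<comment> \<open>The hypothesis on the Jacobian forces \<open>\<beta>_C \<ge> 0\<close>, as there are two distinct points to compare.\<close>
    have "0 \<le> spectral_norm (jacobian C (at 1) - jacobian C (at 0))"
      unfolding spectral_norm_def by (intro onorm_pos_le matrix_vector_mul_bounded_linear)
    also have "\<dots> \<le> \<beta>_C * norm (1 - 0 :: real^'m)" by (rule C_lipschitz)
    finally have "\<beta>_C \<ge> 0"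
      by (simp add: zero_le_mult_iff)
    then show ?thesis
      using lipschitz_on_nonneg[OF h_lipschitz] lipschitz_on_nonneg[OF s_lipschitz] \<alpha>1
      by (simp add: \<psi> L_U)
  qed
  then have bound: "\<psi> \<le> lambda_min (?Q ?K)"
    using loop_weight_ge_at_rejection_bound[OF _ \<nu> \<mu>] weight_le order_trans by blast
  obtain N where N: "N \<le> ?K" "num_rejections g h C s r \<alpha>1 \<nu> \<mu> H xk = enat N"
      "\<not> rejected g h C s r \<alpha>1 xk (?Q N)"
    using num_rejections_first_nonrejected[OF not_rejected[OF bound]] by blast
  have N_accepted: "accepted g h C s r \<alpha>1 xk (?Q N)" if "Pred g h C s r xk (?Q N) \<noteq> 0"
    using N(3) that by (auto simp: accepted_def rejected_def)
  have "num_rejections g h C s r \<alpha>1 \<nu> \<mu> H xk = 0" if "\<mu> \<ge> \<psi>"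
  proof -
    have "\<psi> \<le> lambda_min (?Q 0)" using weight_le[of 0] that by simp
    from num_rejections_first_nonrejected[OF not_rejected[OF this]] show ?thesis
      by (metis le_zero_eq zero_enat_def)
  qed
  then show ?thesis using N N_accepted bound accept by auto
qed

end
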